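(* Let $A$ be a system of $n_A$ qubits and $B$ a system of $n_B$ qubits. Let $\mathcal{P}$ be a CPTP map from operators on $H_{A_1}\otimes H_{B_1}$ (the systems at time $t_1$) to operators on $H_{A_2}\otimes H_{B_2}$ (the systems at time $t_2$) that does not allow signalling from $B$ to $A$, i.e. there exists a completely positive map $\mathcal{T}$ from operators on $H_{A_1}$ to operators on $H_{A_2}$ with $\mathrm{Tr}_{B_2}\mathcal{P}(\rho_{A_1B_1})=\mathcal{T}(\mathrm{Tr}_{B_1}\rho_{A_1B_1})$ for all states $\rho_{A_1B_1}$. Then for every state $\rho_{A_1B_1}$ at time $t_1$, the pseudo-density matrix $R_{B_1A_2}$ (defined in the context) is positive semidefinite, and $f(R_{B_1A_2})=0$.
   Context: Pauli matrices $\sigma_0=\mathbb{1},\sigma_1,\sigma_2,\sigma_3$; multi-qubit Pauli matrices are tensor products of these. The coarse-grained measurement of a Pauli matrix $\Sigma$ on the full system $AB$ is the projective measurement $\{(\mathbb{1}\pm\Sigma)/2\}$ with outcomes $\pm1$ and Lüders update $\rho\mapsto P_\pm\rho P_\pm$. For an $n_B$-qubit Pauli $\tilde\sigma_j$ and an $n_A$-qubit Pauli $\tilde\sigma_k$, consider the experiment: prepare $\rho_{A_1B_1}$; at $t_1$ perform the coarse-grained measurement of $\mathbb{1}_A\otimes\tilde\sigma_j$; apply $\mathcal{P}$ to the post-measurement state; at $t_2$ perform the coarse-grained measurement of $\tilde\sigma_k\otimes\mathbb{1}_B$. Let $\langle\tilde\sigma_j^{B_1},\tilde\sigma_k^{A_2}\rangle$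 be the expectation of the product of the two outcomes. The pseudo-density matrix is $R_{B_1A_2}=2^{-(n_A+n_B)}\sum_{j=0}^{4^{n_B}-1}\sum_{k=0}^{4^{n_A}-1}\langle\tilde\sigma_j^{B_1},\tilde\sigma_k^{A_2}\rangle\,\tilde\sigma_j\otimes\tilde\sigma_k$ (equivalently, the partial trace over $A_1B_2$ of the two-time pseudo-density matrix of the full system $AB$). The PDM negativity (causal monotone) is $f(R)=\|R\|_{tr}-1=\mathrm{Tr}\sqrt{RR^\dagger}-1$. *)

theory Defs
  imports Complex_Main "Jordan_Normal_Form.Matrix"
begin

definition trace :: "complex mat \<Rightarrow> complex" where
  "trace A = (\<Sum>i<dim_row A. A $$ (i,i))"

definition adj :: "complex mat \<Rightarrow> complex mat" where
  "adj A = mat (dim_col A) (dim_row A) (\<lambda>(i,j). cnj (A $$ (j,i)))"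

definition psd :: "nat \<Rightarrow> complex mat \<Rightarrow> bool" where
  "psd n A \<longleftrightarrow> A \<in> carrier_mat n n \<and>
     (\<forall>v :: nat \<Rightarrow> complex.
        let q = (\<Sum>i<n. \<Sum>j<n. cnj (v i) * A $$ (i,j) * v j) in q \<in> \<real> \<and> 0 \<le> Re q)"

definition density :: "nat \<Rightarrow> complex mat \<Rightarrow> bool" where
  "density n \<rho> \<longleftrightarrow> psd n \<rho> \<and> trace \<rho> = 1"

definition kron :: "complex mat \<Rightarrow> complex mat \<Rightarrow> complex mat" where
  "kron A B = mat (dim_row A * dim_row B) (dim_col A * dim_col B)
     (\<lambda>(i,j). A $$ (i div dim_row B, j div dim_col B) * B $$ (i mod dim_row B, j mod dim_col B))"

definition ptrace2 :: "nat \<Rightarrow> nat \<Rightarrow> complex mat \<Rightarrow> complex mat" where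
  "ptrace2 dX dY M = mat dX dX (\<lambda>(i,j). \<Sum>k<dY. M $$ (i*dY+k, j*dY+k))"

definition linear_on :: "nat \<Rightarrow> nat \<Rightarrow> (complex mat \<Rightarrow> complex mat) \<Rightarrow> bool" where
  "linear_on n m P \<longleftrightarrow>
     (\<forall>X \<in> carrier_mat n n. P X \<in> carrier_mat m m) \<and>
     (\<forall>X \<in> carrier_mat n n. \<forall>Y \<in> carrier_mat n n. P (X + Y) = P X + P Y) \<and>
     (\<forall>X \<in> carrier_mat n n. \<forall>c. P (c \<cdot>\<^sub>m X) = c \<cdot>\<^sub>m P X)"

definition blk :: "nat \<Rightarrow> complex mat \<Rightarrow> nat \<Rightarrow> nat \<Rightarrow> complex mat" where
  "blk n X a b = mat n n (\<lambda>(i,j). X $$ (a*n+i, b*n+j))"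

text \<open>id_d tensor P applied to a (d*n) x (d*n) matrix (ancilla = first factor).\<close>
definition ampliate :: "nat \<Rightarrow> nat \<Rightarrow> nat \<Rightarrow> (complex mat \<Rightarrow> complex mat) \<Rightarrow> complex mat \<Rightarrow> complex mat" where
  "ampliate d n m P X = mat (d*m) (d*m)
     (\<lambda>(i,j). P (blk n X (i div m) (j div m)) $$ (i mod m, j mod m))"

definition completely_positive :: "nat \<Rightarrow> nat \<Rightarrow> (complex mat \<Rightarrow> complex mat) \<Rightarrow> bool" where
  "completely_positive n m P \<longleftrightarrow> linear_on n m P \<and>
     (\<forall>d X. psd (d*n) X \<longrightarrow> psd (d*m) (ampliate d n m P X))"

definition cptp :: "nat \<Rightarrow> nat \<Rightarrow> (complex mat \<Rightarrow> complex mat) \<Rightarrow> bool" where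
  "cptp n m P \<longleftrightarrow> completely_positive n m P \<and> (\<forall>X \<in> carrier_mat n n. trace (P X) = trace X)"

definition sigma :: "nat \<Rightarrow> complex mat" where
  "sigma k = (if k = 0 then mat_of_rows_list 2 [[1,0],[0,1]]
         else if k = 1 then mat_of_rows_list 2 [[0,1],[1,0]]
         else if k = 2 then mat_of_rows_list 2 [[0,-\<i>],[\<i>,0]]
         else mat_of_rows_list 2 [[1,0],[0,-1]])"

fun pauli :: "nat \<Rightarrow> nat \<Rightarrow> complex mat" where
  "pauli 0 j = 1\<^sub>m 1"
| "pauli (Suc n) j = kron (sigma (j mod 4)) (pauli n (j div 4))"

text \<open>Projector (1 + a*Sigma)/2 of the coarse-grained measurement, outcome a = +1 or -1.\<close>
definition proj :: "nat \<Rightarrow> complex \<Rightarrow> complex mat \<Rightarrow> complex mat" where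
  "proj d a S = (1/2) \<cdot>\<^sub>m (1\<^sub>m d + a \<cdot>\<^sub>m S)"

text \<open>Full system AB = A tensor B (A first), dA = 2^nA, dB = 2^nB.
  Expectation of the product of the outcomes: measure 1_A (x) sigma_j at t1 (Lueders update),
  apply P, measure sigma_k (x) 1_B at t2.\<close>
definition corr :: "nat \<Rightarrow> nat \<Rightarrow> (complex mat \<Rightarrow> complex mat) \<Rightarrow> complex mat \<Rightarrow> nat \<Rightarrow> nat \<Rightarrow> complex" where
  "corr nA nB P \<rho> j k =
    (let d = 2^nA * 2^nB;
         S1 = kron (1\<^sub>m (2^nA)) (pauli nB j);
         S2 = kron (pauli nA k) (1\<^sub>m (2^nB))
     in \<Sum>a\<in>{1,-1}. \<Sum>b\<in>{1,-1}. a * b *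
          trace (proj d b S2 * P (proj d a S1 * \<rho> * proj d a S1)))"

definition pdm_BA :: "nat \<Rightarrow> nat \<Rightarrow> (complex mat \<Rightarrow> complex mat) \<Rightarrow> complex mat \<Rightarrow> complex mat" where
  "pdm_BA nA nB P \<rho> = mat (2^nB * 2^nA) (2^nB * 2^nA) (\<lambda>(r,c).
     (1 / 2^(nA+nB)) *
       (\<Sum>j<4^nB. \<Sum>k<4^nA. corr nA nB P \<rho> j k * kron (pauli nB j) (pauli nA k) $$ (r,c)))"

definition msqrt :: "nat \<Rightarrow> complex mat \<Rightarrow> complex mat" where
  "msqrt n M = (THE S. psd n S \<and> S * S = M)"

definition trace_norm :: "complex mat \<Rightarrow> real" where
  "trace_norm R = Re (trace (msqrt (dim_row R) (R * adj R)))"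

definition pdm_negativity :: "complex mat \<Rightarrow> real" where
  "pdm_negativity R = trace_norm R - 1"

end

theory Submission
  imports Defs
begin

text \<open>Absence of signalling turns every correlation into
  \<open>Tr (\<sigma>\<^sub>k T (Tr\<^sub>B ((1 \<otimes> \<sigma>\<^sub>j) \<rho>)))\<close>. Completeness of the Pauli basis then identifies the
  pseudo-density matrix with \<open>(id\<^sub>B \<otimes> T)\<close> applied to \<open>\<rho>\<close> with its tensor factors exchanged,
  which is positive because \<open>T\<close> is completely positive. Its trace is \<open>Tr (P \<rho>) = 1\<close>, and the
  trace norm of a positive matrix is its trace, by uniqueness of the positive square root.\<close>

text \<open>The no-signalling hypothesis speaks of normalised states only, whereas the correlations
  involve the unnormalised states left by each outcome, which vanish for an outcome of probability
  zero, and the difference of those states, which is in general not positive. The equation is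
  therefore extended to all positive matrices by rescaling, used for each outcome separately, and
  only then are the outcomes combined by linearity of \<open>T\<close>. The index pattern of the
  Pauli completeness relation is decisive: it makes the expansion of a matrix return the matrix and
  not its transpose, and a partial transpose of \<open>\<rho>\<close> could fail to be positive.
  \<open>psd\<close> asserts only that a quadratic form is real and nonnegative, and
  \<open>msqrt\<close> is a definite description. Hermitian symmetry and uniqueness of the root are
  derived from the form alone, without eigenvalues.\<close>

section \<open>Index arithmetic for product dimensions\<close>

lemma sum_lessThan_mult:
  fixes f :: "nat \<Rightarrow> 'a::comm_monoid_add"
  shows "(\<Sum>i<a*b. f i) = (\<Sum>x<a. \<Sum>y<b. f (x*b+y))"
proof (induction a)
  case (Suc a)
  have "(\<Sum>i<Suc a*b. f i) = (\<Sum>i<a*b. f i) + (\<Sum>i=a*b..<a*b+b. f i)"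
    using sum.atLeastLessThan_concat[of 0 "a*b" "a*b+b" f]
    by (simp add: lessThan_atLeast0 add.commute)
  also have "(\<Sum>i=a*b..<a*b+b. f i) = (\<Sum>y<b. f (a*b+y))"
    using sum.shift_bounds_nat_ivl[of f 0 "a*b" b]
    by (simp add: lessThan_atLeast0 add.commute)
  finally show ?case using Suc by simp
qed simp

text \<open>The index \<open>x*a+y\<close> of \<open>B \<otimes> A\<close> is sent to the index
  \<open>y*b+x\<close> of \<open>A \<otimes> B\<close>, so this is the exchange of a double sum
  written in flat indices.\<close>

lemma sum_lessThan_mult_swap:
  fixes f :: "nat \<Rightarrow> 'a::comm_monoid_add"
  shows "(\<Sum>i<b*a. f (i mod a * b + i div a)) = (\<Sum>i<a*b. f i)"
proof -
  have "(\<Sum>i<b*a. f (i mod a * b + i div a)) = (\<Sum>x<b. \<Sum>y<a. f (y*b+x))"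
    unfolding sum_lessThan_mult by (intro sum.cong refl) auto
  also have "\<dots> = (\<Sum>y<a. \<Sum>x<b. f (y*b+x))" by (rule sum.swap)
  finally show ?thesis unfolding sum_lessThan_mult .
qed

lemma mult_add_less_mult:
  fixes x y a b :: nat
  assumes "x < a" "y < b"
  shows "x*b+y < a*b"
proof -
  have "x*b+y < Suc x * b" using assms by simp
  also have "\<dots> \<le> a*b" using assms by (intro mult_le_mono1) simp
  finally show ?thesis .
qed

lemma mod_less_mult: "(i::nat) < a*b \<Longrightarrow> i mod b < b"
  by (cases b) auto

section \<open>Positive matrices through their sesquilinear form\<close>

text \<open>\<open>psd\<close> constrains only the diagonal \<open>u = v\<close>; two independent
  arguments make polarisation and the extraction of single entries possible.\<close>

definition sesq :: "nat \<Rightarrow> complex mat \<Rightarrow> (nat \<Rightarrow> complex) \<Rightarrow> (nat \<Rightarrow> complex) \<Rightarrow> complex" where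
  "sesq n A u v = (\<Sum>i<n. \<Sum>j<n. cnj (u i) * A $$ (i,j) * v j)"

lemma psd_iff_sesq:
  "psd n A \<longleftrightarrow> A \<in> carrier_mat n n \<and> (\<forall>v. sesq n A v v \<in> \<real> \<and> 0 \<le> Re (sesq n A v v))"
  by (simp add: psd_def sesq_def Let_def)

lemma psd_carrier: "psd n A \<Longrightarrow> A \<in> carrier_mat n n"
  and psd_sesq_real: "psd n A \<Longrightarrow> sesq n A v v \<in> \<real>"
  and psd_sesq_nonneg: "psd n A \<Longrightarrow> 0 \<le> Re (sesq n A v v)"
  by (auto simp: psd_iff_sesq)

lemma sesq_add_left: "sesq n A (\<lambda>i. u i + w i) v = sesq n A u v + sesq n A w v"
  by (simp add: sesq_def algebra_simps sum.distrib)

lemma sesq_add_right: "sesq n A u (\<lambda>i. v i + w i) = sesq n A u v + sesq n A u w"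
  by (simp add: sesq_def algebra_simps sum.distrib)

lemma sesq_scale_left: "sesq n A (\<lambda>i. c * u i) v = cnj c * sesq n A u v"
  by (simp add: sesq_def sum_distrib_left algebra_simps)

lemma sesq_scale_right: "sesq n A u (\<lambda>i. c * v i) = c * sesq n A u v"
  by (simp add: sesq_def sum_distrib_left algebra_simps)

lemma sesq_unit_left:
  assumes "k < n"
  shows "sesq n A (\<lambda>i. if i = k then 1 else 0) v = (\<Sum>j<n. A $$ (k,j) * v j)"
proof -
  have "sesq n A (\<lambda>i. if i = k then 1 else 0) v =
      (\<Sum>i<n. if i = k then (\<Sum>j<n. A $$ (k,j) * v j) else 0)"
    unfolding sesq_def by (intro sum.cong) auto
  then show ?thesis using assms by simp
qed

lemma sesq_units:
  assumes "k < n" "l < n"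
  shows "sesq n A (\<lambda>i. if i = k then 1 else 0) (\<lambda>i. if i = l then 1 else 0) = A $$ (k,l)"
  using assms by (simp add: sesq_unit_left if_distrib[of "\<lambda>x. _ * x"] cong: if_cong)

text \<open>Polarisation: the form is real at \<open>u + v\<close> and at \<open>u + \<i> v\<close>.
  The first fact relates the imaginary parts of the two mixed terms, the second their real
  parts.\<close>

lemma psd_sesq_cnj:
  assumes "psd n A"
  shows "sesq n A u v = cnj (sesq n A v u)"
proof -
  have "sesq n A (\<lambda>i. u i + v i) (\<lambda>i. u i + v i) =
      sesq n A u u + sesq n A v v + (sesq n A u v + sesq n A v u)"
    by (simp add: sesq_add_left sesq_add_right)
  then have 1: "Im (sesq n A u v) + Im (sesq n A v u) = 0"
    using psd_sesq_real[OF assms, of "\<lambda>i. u i + v i"] psd_sesq_real[OF assms, of u]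
      psd_sesq_real[OF assms, of v] by (simp add: complex_is_Real_iff)
  have "sesq n A (\<lambda>i. u i + \<i> * v i) (\<lambda>i. u i + \<i> * v i) =
      sesq n A u u + sesq n A v v + (\<i> * sesq n A u v - \<i> * sesq n A v u)"
    by (simp add: sesq_add_left sesq_add_right sesq_scale_left sesq_scale_right algebra_simps)
  then have 2: "Re (sesq n A u v) - Re (sesq n A v u) = 0"
    using psd_sesq_real[OF assms, of "\<lambda>i. u i + \<i> * v i"] psd_sesq_real[OF assms, of u]
      psd_sesq_real[OF assms, of v] by (simp add: complex_is_Real_iff)
  show ?thesis using 1 2 by (simp add: complex_eq_iff)
qed

lemma psd_index_cnj: "psd n A \<Longrightarrow> i < n \<Longrightarrow> j < n \<Longrightarrow> A $$ (i,j) = cnj (A $$ (j,i))"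
  using psd_sesq_cnj[of n A "\<lambda>k. if k = i then 1 else 0" "\<lambda>k. if k = j then 1 else 0"]
  by (simp only: sesq_units)

lemma psd_adj: "psd n A \<Longrightarrow> adj A = A"
  using psd_carrier[of n A] by (intro eq_matI) (auto simp: adj_def psd_index_cnj[symmetric])

lemma linear_plus_quadratic_nonneg:
  fixes a b :: real
  assumes "\<And>t. 0 \<le> t * a + t^2 * b" and b: "b \<ge> 0"
  shows "a = 0"
proof -
  \<comment> \<open>The denominator \<open>b + 1\<close> cannot vanish, and at
    \<open>t = - k\<close> the expression collapses to \<open>- (k^2)\<close>.\<close>
  define k where "k = a / (b + 1)"
  have a: "a = k * (b + 1)" using b by (simp add: k_def)
  have "0 \<le> (- k) * a + (- k)^2 * b" by (rule assms)
  also have "\<dots> = - (k^2)" by (simp add: a algebra_simps power2_eq_square)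
  finally show ?thesis by (simp add: a)
qed

text \<open>At \<open>x + t y\<close> with real \<open>t\<close> the constant term of the form is
  zero, so nonnegativity for every \<open>t\<close> forces the linear term, twice the real part, to
  vanish. Replacing \<open>y\<close> by \<open>\<i> y\<close> gives the imaginary part.\<close>

lemma psd_sesq_eq_0:
  assumes A: "psd n A" and x: "sesq n A x x = 0"
  shows "sesq n A y x = 0"
proof -
  have Re0: "Re (sesq n A y x) = 0" for y
  proof -
    have "2 * Re (sesq n A y x) = 0"
    proof (rule linear_plus_quadratic_nonneg)
      fix t :: real
      have "sesq n A (\<lambda>i. x i + complex_of_real t * y i) (\<lambda>i. x i + complex_of_real t * y i) =
          t * (cnj (sesq n A y x) + sesq n A y x) + t^2 * sesq n A y y"
        using x psd_sesq_cnj[OF A, of x y]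
        by (simp add: sesq_add_left sesq_add_right sesq_scale_left sesq_scale_right
            algebra_simps power2_eq_square)
      then show "0 \<le> t * (2 * Re (sesq n A y x)) + t^2 * Re (sesq n A y y)"
        using psd_sesq_nonneg[OF A, of "\<lambda>i. x i + complex_of_real t * y i"]
        by (simp add: algebra_simps flip: of_real_power)
    qed (rule psd_sesq_nonneg[OF A])
    then show ?thesis by simp
  qed
  have "Re (sesq n A (\<lambda>i. \<i> * y i) x) = Im (sesq n A y x)"
    by (simp add: sesq_scale_left)
  then show ?thesis using Re0[of y] Re0[of "\<lambda>i. \<i> * y i"] by (simp add: complex_eq_iff)
qed

lemma psd_sesq_eq_0_mult:
  assumes "psd n A" "sesq n A x x = 0" "i < n"
  shows "(\<Sum>j<n. A $$ (i,j) * x j) = 0"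
  using psd_sesq_eq_0[OF assms(1,2), of "\<lambda>k. if k = i then 1 else 0"] assms(3)
  by (simp add: sesq_unit_left)

lemma psd_sum_sesq_eq_0:
  assumes A: "psd n A" and "finite I"
    and sum: "(\<Sum>s\<in>I. Re (sesq n A (x s) (x s))) = 0" and s: "s \<in> I"
  shows "sesq n A (x s) (x s) = 0"
proof -
  have "Re (sesq n A (x s) (x s)) = 0"
    using sum_nonneg_eq_0_iff[THEN iffD1, OF \<open>finite I\<close> _ sum] psd_sesq_nonneg[OF A] s by blast
  then show ?thesis
    using psd_sesq_real[OF A] by (simp add: complex_is_Real_iff complex_eq_iff)
qed

text \<open>Every unit vector becomes a null vector of the form, which kills all entries and not
  only the diagonal ones. This settles measurement outcomes of probability zero.\<close>

lemma psd_trace_eq_0: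
  assumes A: "psd n A" and tr: "trace A = 0"
  shows "A = 0\<^sub>m n n"
proof (intro eq_matI)
  have c: "A \<in> carrier_mat n n" by (rule psd_carrier[OF A])
  fix i j assume "i < dim_row (0\<^sub>m n n)" "j < dim_col (0\<^sub>m n n)"
  then have ij: "i < n" "j < n" by auto
  let ?e = "\<lambda>j k. if k = j then 1 else 0 :: complex"
  have "(\<Sum>j<n. Re (sesq n A (?e j) (?e j))) = Re (trace A)"
    using carrier_matD[OF c] by (simp add: trace_def sesq_units)
  then have "sesq n A (?e j) (?e j) = 0"
    using psd_sum_sesq_eq_0[OF A finite_lessThan, of ?e n j] tr ij by simp
  from psd_sesq_eq_0[OF A this, of "?e i"] show "A $$ (i,j) = 0\<^sub>m n n $$ (i,j)"
    using ij by (simp add: sesq_units)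
qed (use psd_carrier[OF A] in auto)

section \<open>Congruences and uniqueness of the positive square root\<close>

lemma index_mult_mat_sum:
  "A \<in> carrier_mat n m \<Longrightarrow> B \<in> carrier_mat m l \<Longrightarrow> i < n \<Longrightarrow> j < l \<Longrightarrow>
   (A * B) $$ (i,j) = (\<Sum>k<m. A $$ (i,k) * B $$ (k,j))"
  by (simp add: scalar_prod_def lessThan_atLeast0)

lemma trace_add:
  "A \<in> carrier_mat n n \<Longrightarrow> B \<in> carrier_mat n n \<Longrightarrow> trace (A + B) = trace A + trace B"
  by (simp add: trace_def sum.distrib)

lemma trace_mult:
  assumes "A \<in> carrier_mat n n" "B \<in> carrier_mat n n"
  shows "trace (A * B) = (\<Sum>i<n. \<Sum>j<n. A $$ (i,j) * B $$ (j,i))"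
  using assms by (simp add: trace_def scalar_prod_def lessThan_atLeast0)

lemma trace_mult_commute:
  assumes "A \<in> carrier_mat n n" "B \<in> carrier_mat n n"
  shows "trace (A * B) = trace (B * A)"
  unfolding trace_mult[OF assms] trace_mult[OF assms(2,1)]
  by (subst sum.swap) (simp add: mult.commute)

lemma sesq_mult_right:
  assumes "Y \<in> carrier_mat n n" "C \<in> carrier_mat n n"
  shows "sesq n (Y * C) u v = sesq n Y u (\<lambda>k. \<Sum>j<n. C $$ (k,j) * v j)"
proof -
  have "(\<Sum>j<n. cnj (u i) * (Y * C) $$ (i,j) * v j) =
      (\<Sum>k<n. cnj (u i) * Y $$ (i,k) * (\<Sum>j<n. C $$ (k,j) * v j))" if "i < n" for i
  proof -
    have "(\<Sum>j<n. cnj (u i) * (Y * C) $$ (i,j) * v j) =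
        (\<Sum>j<n. \<Sum>k<n. cnj (u i) * Y $$ (i,k) * (C $$ (k,j) * v j))"
      using that by (intro sum.cong refl)
        (simp add: index_mult_mat_sum[OF assms] sum_distrib_left sum_distrib_right ac_simps
         del: index_mult_mat)
    then show ?thesis by (subst (asm) sum.swap) (simp add: sum_distrib_left)
  qed
  then show ?thesis by (simp add: sesq_def)
qed

lemma sesq_mult_left:
  assumes "Y \<in> carrier_mat n n" "C \<in> carrier_mat n n"
  shows "sesq n (C * Y) u v = sesq n Y (\<lambda>k. \<Sum>i<n. cnj (C $$ (i,k)) * u i) v"
proof -
  have "(\<Sum>i<n. cnj (u i) * (C * Y) $$ (i,j) * v j) =
      (\<Sum>k<n. cnj (\<Sum>i<n. cnj (C $$ (i,k)) * u i) * Y $$ (k,j) * v j)" if "j < n" for j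
  proof -
    have "(\<Sum>i<n. cnj (u i) * (C * Y) $$ (i,j) * v j) =
        (\<Sum>i<n. \<Sum>k<n. (C $$ (i,k) * cnj (u i)) * Y $$ (k,j) * v j)"
      using that by (intro sum.cong refl)
        (simp add: index_mult_mat_sum[OF assms(2,1)] sum_distrib_left sum_distrib_right ac_simps
         del: index_mult_mat)
    then show ?thesis by (subst (asm) sum.swap) (simp add: sum_distrib_right)
  qed
  then have "(\<Sum>j<n. \<Sum>i<n. cnj (u i) * (C * Y) $$ (i,j) * v j) =
      (\<Sum>j<n. \<Sum>k<n. cnj (\<Sum>i<n. cnj (C $$ (i,k)) * u i) * Y $$ (k,j) * v j)"
    by (simp del: index_mult_mat)
  then show ?thesis unfolding sesq_def by (subst sum.swap, subst (2) sum.swap)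
qed

lemma sesq_congruence:
  assumes "X \<in> carrier_mat n n" "B \<in> carrier_mat n n" "adj B = B"
  shows "sesq n (B * X * B) v v =
    sesq n X (\<lambda>k. \<Sum>j<n. B $$ (k,j) * v j) (\<lambda>k. \<Sum>j<n. B $$ (k,j) * v j)"
proof -
  have B: "cnj (B $$ (i,k)) = B $$ (k,i)" if "i < n" "k < n" for i k
  proof -
    have "B $$ (k,i) = adj B $$ (k,i)" by (simp add: assms(3))
    also have "\<dots> = cnj (B $$ (i,k))" using assms(2) that by (simp add: adj_def)
    finally show ?thesis by simp
  qed
  have "sesq n (B * X * B) v v =
      sesq n X (\<lambda>k. \<Sum>i<n. cnj (B $$ (i,k)) * v i) (\<lambda>k. \<Sum>j<n. B $$ (k,j) * v j)"
    unfolding sesq_mult_right[OF mult_carrier_mat[OF assms(2,1)] assms(2)]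
    by (rule sesq_mult_left[OF assms(1,2)])
  also have "\<dots> = sesq n X (\<lambda>k. \<Sum>j<n. B $$ (k,j) * v j) (\<lambda>k. \<Sum>j<n. B $$ (k,j) * v j)"
    unfolding sesq_def using B by (intro sum.cong refl) simp
  finally show ?thesis .
qed

lemma psd_congruence:
  assumes "psd n X" "B \<in> carrier_mat n n" "adj B = B"
  shows "psd n (B * X * B)"
  unfolding psd_iff_sesq[of n "B * X * B"] sesq_congruence[OF psd_carrier[OF assms(1)] assms(2,3)]
  using assms(2) psd_carrier[OF assms(1)] psd_sesq_real[OF assms(1)] psd_sesq_nonneg[OF assms(1)]
  by (intro conjI allI mult_carrier_mat)

text \<open>With \<open>D = S - R\<close> one has \<open>S D + D R = S\<^sup>2 - R\<^sup>2 = 0\<close>, so the positive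
  matrices \<open>D S D\<close> and \<open>D R D\<close> have traces adding up to zero; hence \<open>S D = R D = 0\<close>
  and \<open>D\<^sup>2 = 0\<close>.\<close>

lemma psd_sqrt_unique:
  assumes S: "psd n S" and R: "psd n R" and eq: "S * S = R * R"
  shows "S = R"
proof -
  define D where "D = S - R"
  have c[simp]: "S \<in> carrier_mat n n" "R \<in> carrier_mat n n" "D \<in> carrier_mat n n"
    using psd_carrier[OF S] psd_carrier[OF R] by (auto simp: D_def)
  have D_ij: "D $$ (i,j) = S $$ (i,j) - R $$ (i,j)" if "i < n" "j < n" for i j
    using that c(1,2) unfolding D_def by (simp del: c)
  have D_cnj: "D $$ (i,j) = cnj (D $$ (j,i))" if "i < n" "j < n" for i j
    using that psd_index_cnj[OF S that] psd_index_cnj[OF R that] by (simp add: D_ij)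
  have adjD: "adj D = D"
    using carrier_matD[OF c(3)] by (intro eq_matI) (auto simp: adj_def D_cnj[symmetric])
  have "S * D + D * R = (S * S - S * R) + (S * R - R * R)"
    unfolding D_def using c(1,2)
    by (simp add: mult_minus_distrib_mat[of _ n n _ n] minus_mult_distrib_mat[of _ n n _ _ n])
  also have "\<dots> = 0\<^sub>m n n"
    unfolding eq using carrier_matD[OF c(1)] carrier_matD[OF c(2)] by (intro eq_matI) auto
  finally have SD: "S * D + D * R = 0\<^sub>m n n" .
  \<comment> \<open>Cyclicity moves one \<open>D\<close> of \<open>D * R * D\<close> to the front,
    after which \<open>D\<close> factors out on the left of \<open>S * D + D * R\<close>.\<close>
  have "trace (D * S * D) + trace (D * R * D) = trace (D * (S * D)) + trace (D * (D * R))"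
    using trace_mult_commute[of "D * R" n D] by (simp add: assoc_mult_mat[of _ n n _ n _ n])
  also have "\<dots> = trace (D * (S * D + D * R))"
    using mult_carrier_mat[OF c(1,3)] mult_carrier_mat[OF c(3,2)]
    by (simp add: mult_add_distrib_mat[OF c(3) mult_carrier_mat[OF c(1,3)] mult_carrier_mat[OF c(3,2)]]
        trace_add[OF mult_carrier_mat[OF c(3)] mult_carrier_mat[OF c(3)]])
  also have "\<dots> = 0" unfolding SD right_mult_zero_mat[OF c(3)] by (simp add: trace_def)
  finally have tr: "trace (D * S * D) + trace (D * R * D) = 0" .
  let ?e = "\<lambda>j k. if k = j then 1 else 0 :: complex"
  \<comment> \<open>Column \<open>i\<close> of \<open>D\<close> is \<open>D\<close> applied to the
    unit vector \<open>i\<close>, so the form of \<open>X\<close> at that column is a diagonal entry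
    of the congruence.\<close>
  have entry: "sesq n X (\<lambda>k. D $$ (k,i)) (\<lambda>k. D $$ (k,i)) = (D * X * D) $$ (i,i)"
    if "i < n" "X \<in> carrier_mat n n" for i X
  proof -
    have col: "(\<lambda>k. \<Sum>j<n. D $$ (k,j) * ?e i j) = (\<lambda>k. D $$ (k,i))"
      using that by (simp add: if_distrib[of "\<lambda>x. _ * x"] cong: if_cong)
    show ?thesis
      using sesq_congruence[OF that(2) c(3) adjD, of "?e i"] that
      unfolding col by (simp only: sesq_units)
  qed
  have trX: "trace (D * X * D) = (\<Sum>i<n. sesq n X (\<lambda>k. D $$ (k,i)) (\<lambda>k. D $$ (k,i)))"
    if "X \<in> carrier_mat n n" for X
  proof -
    have "dim_row (D * X * D) = n" using carrier_matD[OF c(3)] by simp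
    then show ?thesis unfolding trace_def using that by (simp add: entry del: index_mult_mat)
  qed
  let ?q = "\<lambda>X i. sesq n X (\<lambda>k. D $$ (k,i)) (\<lambda>k. D $$ (k,i))"
  have "(\<Sum>i<n. Re (?q S i)) + (\<Sum>i<n. Re (?q R i)) = 0"
    using arg_cong[OF tr, of Re] unfolding trX[OF c(1)] trX[OF c(2)] by simp
  moreover have "(\<Sum>i<n. Re (?q S i)) \<ge> 0" "(\<Sum>i<n. Re (?q R i)) \<ge> 0"
    by (intro sum_nonneg psd_sesq_nonneg S R)+
  ultimately have "(\<Sum>i<n. Re (?q S i)) = 0" "(\<Sum>i<n. Re (?q R i)) = 0" by linarith+
  then have z: "?q S i = 0" "?q R i = 0" if "i < n" for i
    using that psd_sum_sesq_eq_0[OF S finite_lessThan, of "\<lambda>i k. D $$ (k,i)" n i]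
      psd_sum_sesq_eq_0[OF R finite_lessThan, of "\<lambda>i k. D $$ (k,i)" n i] by blast+
  have DD: "(\<Sum>k<n. D $$ (i,k) * D $$ (k,j)) = 0" if "i < n" "j < n" for i j
  proof -
    have "(\<Sum>k<n. S $$ (i,k) * D $$ (k,j)) = 0" "(\<Sum>k<n. R $$ (i,k) * D $$ (k,j)) = 0"
      using psd_sesq_eq_0_mult[OF S, of "\<lambda>k. D $$ (k,j)" i]
        psd_sesq_eq_0_mult[OF R, of "\<lambda>k. D $$ (k,j)" i] z[of j] that by blast+
    moreover have "(\<Sum>k<n. D $$ (i,k) * D $$ (k,j)) =
        (\<Sum>k<n. S $$ (i,k) * D $$ (k,j)) - (\<Sum>k<n. R $$ (i,k) * D $$ (k,j))"
      unfolding sum_subtractf[symmetric] left_diff_distrib[symmetric]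
      using that by (intro sum.cong refl) (simp add: D_ij)
    ultimately show ?thesis by simp
  qed
  have D0: "D $$ (i,j) = 0" if ij: "i < n" "j < n" for i j
  proof -
    \<comment> \<open>\<open>D\<close> is Hermitian, so the diagonal entry \<open>j\<close> of
      \<open>D * D\<close> is the squared norm of column \<open>j\<close>.\<close>
    have "(\<Sum>k<n. D $$ (j,k) * D $$ (k,j)) = of_real (\<Sum>k<n. (cmod (D $$ (k,j)))^2)"
      unfolding of_real_sum
      by (intro sum.cong refl)
        (use ij in \<open>simp add: complex_norm_square mult.commute D_cnj[symmetric] del: of_real_power\<close>)
    then have "(\<Sum>k<n. (cmod (D $$ (k,j)))^2) = 0" using DD[OF ij(2) ij(2)] by (metis of_real_eq_0_iff)
    then show ?thesis using ij by (subst (asm) sum_nonneg_eq_0_iff) auto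
  qed
  show ?thesis
    using D0 carrier_matD[OF c(1)] carrier_matD[OF c(2)] by (intro eq_matI) (auto simp: D_ij)
qed

text \<open>\<open>R\<close> itself witnesses existence for the definite description, so only
  uniqueness requires an argument.\<close>

lemma msqrt_psd_square:
  assumes "psd n R"
  shows "msqrt n (R * R) = R"
  unfolding msqrt_def using assms psd_sqrt_unique[of n _ R] by (intro the_equality) auto

lemma trace_norm_psd:
  assumes "psd n R"
  shows "trace_norm R = Re (trace R)"
  using psd_carrier[OF assms] by (simp add: trace_norm_def psd_adj[OF assms] msqrt_psd_square[OF assms])

section \<open>Exchange of tensor factors and linear maps on matrices\<close>

lemma psd_swap_factors:
  assumes "psd (a*b) A"
  shows "psd (b*a) (mat (b*a) (b*a)
    (\<lambda>(i,j). A $$ (i mod a * b + i div a, j mod a * b + j div a)))" (is "psd _ ?X")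
proof -
  have "sesq (b*a) ?X v v = sesq (a*b) A (\<lambda>k. v (k mod b * a + k div b)) (\<lambda>k. v (k mod b * a + k div b))"
    for v
  proof -
    let ?p = "\<lambda>i. i mod a * b + i div a" and ?w = "\<lambda>k. v (k mod b * a + k div b)"
    \<comment> \<open>The index map in \<open>?w\<close> inverts \<open>?p\<close>: since
      \<open>i div a < b\<close>, division of \<open>?p i\<close> by \<open>b\<close> returns
      \<open>i mod a\<close> as quotient and \<open>i div a\<close> as remainder.\<close>
    have w: "v i = ?w (?p i)" if "i < b*a" for i
    proof -
      have "i div a < b" using that by (simp add: less_mult_imp_div_less)
      then show ?thesis by simp
    qed
    have "sesq (b*a) ?X v v =
        (\<Sum>i<b*a. \<Sum>j<b*a. cnj (?w (?p i)) * A $$ (?p i, ?p j) * ?w (?p j))"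
      unfolding sesq_def by (intro sum.cong refl arg_cong2[of _ _ _ _ "(*)"])
        (use w in auto)
    also have "\<dots> = (\<Sum>i<b*a. \<Sum>j<a*b. cnj (?w (?p i)) * A $$ (?p i, j) * ?w j)"
      by (rule sum.cong[OF refl]) (rule sum_lessThan_mult_swap)
    also have "\<dots> = sesq (a*b) A ?w ?w"
      unfolding sesq_def
      by (rule sum_lessThan_mult_swap)
    finally show ?thesis .
  qed
  then show ?thesis using assms by (simp add: psd_iff_sesq)
qed

lemma linear_on_carrier: "linear_on n m T \<Longrightarrow> X \<in> carrier_mat n n \<Longrightarrow> T X \<in> carrier_mat m m"
  and linear_on_add: "linear_on n m T \<Longrightarrow> X \<in> carrier_mat n n \<Longrightarrow> Y \<in> carrier_mat n n \<Longrightarrow>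
    T (X + Y) = T X + T Y"
  and linear_on_smult: "linear_on n m T \<Longrightarrow> X \<in> carrier_mat n n \<Longrightarrow> T (c \<cdot>\<^sub>m X) = c \<cdot>\<^sub>m T X"
  by (simp_all add: linear_on_def)

lemma linear_on_sum:
  assumes T: "linear_on n m T" and "finite I" and X: "\<And>s. s \<in> I \<Longrightarrow> X s \<in> carrier_mat n n"
    and pq: "p < m" "q < m"
  shows "T (mat n n (\<lambda>(i,j). \<Sum>s\<in>I. c s * X s $$ (i,j))) $$ (p,q) = (\<Sum>s\<in>I. c s * T (X s) $$ (p,q))"
  using assms(2) X
proof (induction I rule: finite_induct)
  case empty
  \<comment> \<open>\<open>linear_on\<close> has no clause for the zero matrix; writing it as a
    multiple by 0 reduces \<open>T 0 = 0\<close> to homogeneity.\<close>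
  have *: "mat n n (\<lambda>(i,j). \<Sum>s\<in>{}. c s * X s $$ (i,j)) = 0 \<cdot>\<^sub>m 0\<^sub>m n n"
    by (intro eq_matI) auto
  have "T (0 \<cdot>\<^sub>m 0\<^sub>m n n) = 0 \<cdot>\<^sub>m T (0\<^sub>m n n)" "T (0\<^sub>m n n) \<in> carrier_mat m m"
    by (rule linear_on_smult[OF T zero_carrier_mat], rule linear_on_carrier[OF T zero_carrier_mat])
  then have "T (0 \<cdot>\<^sub>m 0\<^sub>m n n) $$ (p,q) = 0"
    using pq by (metis index_smult_mat(1) carrier_matD mult_zero_left)
  then show ?case unfolding * by simp
next
  case (insert s I)
  define Y where "Y = mat n n (\<lambda>(i,j). \<Sum>s\<in>I. c s * X s $$ (i,j))"
  have IH: "T Y $$ (p,q) = (\<Sum>s\<in>I. c s * T (X s) $$ (p,q))"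
    unfolding Y_def by (intro insert.IH insert.prems) simp
  have Xs: "X s \<in> carrier_mat n n" using insert by simp
  have Y: "Y \<in> carrier_mat n n" by (simp add: Y_def)
  have cX: "c s \<cdot>\<^sub>m X s \<in> carrier_mat n n" using Xs by simp
  have *: "mat n n (\<lambda>(i,j). \<Sum>s\<in>insert s I. c s * X s $$ (i,j)) = c s \<cdot>\<^sub>m X s + Y"
    using carrier_matD[OF Xs] insert.hyps by (intro eq_matI) (auto simp: Y_def)
  have "T (c s \<cdot>\<^sub>m X s + Y) = T (c s \<cdot>\<^sub>m X s) + T Y" "T (c s \<cdot>\<^sub>m X s) = c s \<cdot>\<^sub>m T (X s)"
    "T (X s) \<in> carrier_mat m m" "T Y \<in> carrier_mat m m"
    by (rule linear_on_add[OF T cX Y] linear_on_smult[OF T Xs] linear_on_carrier[OF T Xs]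
        linear_on_carrier[OF T Y])+
  then show ?case unfolding * using pq insert.hyps IH by simp
qed

section \<open>Kronecker products and the Pauli basis\<close>

lemma kron_carrier:
  "A \<in> carrier_mat a a' \<Longrightarrow> B \<in> carrier_mat b b' \<Longrightarrow> kron A B \<in> carrier_mat (a*b) (a'*b')"
  by (auto simp: kron_def)

lemma kron_index:
  assumes "A \<in> carrier_mat a a'" "B \<in> carrier_mat b b'" "x < a" "y < b" "x' < a'" "y' < b'"
  shows "kron A B $$ (x*b+y, x'*b'+y') = A $$ (x,x') * B $$ (y,y')"
  using assms mult_add_less_mult[of x a y b] mult_add_less_mult[of x' a' y' b']
  by (auto simp: kron_def)

lemma kron_index_div:
  assumes "A \<in> carrier_mat a a'" "B \<in> carrier_mat b b'" "i < a*b" "j < a'*b'"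
  shows "kron A B $$ (i, j) = A $$ (i div b,j div b') * B $$ (i mod b,j mod b')"
  using assms by (auto simp: kron_def)

lemma sigma_carrier: "sigma k \<in> carrier_mat 2 2"
  by (intro carrier_matI) (auto simp: sigma_def mat_of_rows_list_def)

lemma pauli_carrier: "pauli n j \<in> carrier_mat (2^n) (2^n)"
  by (induction n arbitrary: j) (auto intro!: kron_carrier sigma_carrier)

lemma less_2_cases_nat: "(x::nat) < 2 \<longleftrightarrow> x = 0 \<or> x = 1"
  by auto

lemma sigma_hermitian: "x < 2 \<Longrightarrow> y < 2 \<Longrightarrow> cnj (sigma k $$ (x,y)) = sigma k $$ (y,x)"
  by (auto simp: sigma_def mat_of_rows_list_def less_2_cases_nat)

lemma pauli_hermitian: "x < 2^n \<Longrightarrow> y < 2^n \<Longrightarrow> cnj (pauli n k $$ (x,y)) = pauli n k $$ (y,x)"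
proof (induction n arbitrary: x y k)
  case (Suc n)
  have *: "x div 2^n < 2" "y div 2^n < 2"
    using Suc.prems by (auto intro: less_mult_imp_div_less)
  show ?case
    using Suc.prems * by (simp add: kron_index_div[OF sigma_carrier pauli_carrier] sigma_hermitian Suc.IH)
qed auto

text \<open>In tensor notation the sum of \<open>sigma j \<otimes> sigma j\<close> is twice the swap
  operator, checked on its 16 entries.\<close>

lemma sigma_completeness:
  assumes "r < 2" "c < 2" "s < 2" "t < 2"
  shows "(\<Sum>j<4. sigma j $$ (r,c) * sigma j $$ (s,t)) = (if r = t \<and> c = s then 2 else 0)"
  using assms unfolding less_2_cases_nat
  by (auto simp: sigma_def mat_of_rows_list_def eval_nat_numeral)

text \<open>The relation factorises over qubits. The lowest base-4 digit of \<open>j\<close> labels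
  the first tensor factor, which carries the highest bit of the row and column indices; hence
  \<open>j\<close> splits by 4 while \<open>r\<close> and \<open>c\<close> split by
  \<open>2^n\<close>.\<close>

lemma pauli_completeness:
  assumes "r < 2^n" "c < 2^n" "s < 2^n" "t < 2^n"
  shows "(\<Sum>j<4^n. pauli n j $$ (r,c) * pauli n j $$ (s,t)) = (if r = t \<and> c = s then 2^n else 0)"
  using assms
proof (induction n arbitrary: r c s t)
  case (Suc n)
  let ?d = "2^n :: nat"
  have d: "x div ?d < 2" "x mod ?d < ?d" if "x < 2 ^ Suc n" for x
    using that by (auto intro: less_mult_imp_div_less)
  have pauli: "pauli (Suc n) (x*4+y) $$ (r,c) =
      sigma y $$ (r div ?d, c div ?d) * pauli n x $$ (r mod ?d, c mod ?d)"
    if "r < 2^Suc n" "c < 2^Suc n" "y < 4" for x y r c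
    using that by (simp add: kron_index_div[OF sigma_carrier pauli_carrier])
  have "(\<Sum>j<4^Suc n. pauli (Suc n) j $$ (r,c) * pauli (Suc n) j $$ (s,t)) =
      (\<Sum>x<4^n. \<Sum>y<4. pauli (Suc n) (x*4+y) $$ (r,c) * pauli (Suc n) (x*4+y) $$ (s,t))"
    using sum_lessThan_mult[of "\<lambda>j. pauli (Suc n) j $$ (r,c) * pauli (Suc n) j $$ (s,t)" "4^n" 4]
    by (simp add: mult.commute del: pauli.simps)
  also have "\<dots> = (\<Sum>x<4^n. \<Sum>y<4.
      (pauli n x $$ (r mod ?d, c mod ?d) * pauli n x $$ (s mod ?d, t mod ?d)) *
      (sigma y $$ (r div ?d, c div ?d) * sigma y $$ (s div ?d, t div ?d)))"
    using Suc.prems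
    by (intro sum.cong refl) (simp only: pauli lessThan_iff mult.assoc mult.left_commute mult.commute)
  also have "\<dots> = (if r mod ?d = t mod ?d \<and> c mod ?d = s mod ?d then 2^n else 0) *
      (if r div ?d = t div ?d \<and> c div ?d = s div ?d then 2 else 0)"
    using Suc.prems
    by (simp add: sum_product[symmetric] Suc.IH d sigma_completeness)
  also have "\<dots> = (if r = t \<and> c = s then 2^Suc n else 0)"
  proof -
    have "r = t \<longleftrightarrow> r div ?d = t div ?d \<and> r mod ?d = t mod ?d"
      "c = s \<longleftrightarrow> c div ?d = s div ?d \<and> c mod ?d = s mod ?d"
      by (metis div_mult_mod_eq)+
    then show ?thesis by auto
  qed
  finally show ?case .
qed auto

text \<open>Contracting the completeness relation with \<open>Y\<close> selects \<open>i = q\<close>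
  and \<open>j = p\<close>, hence the entry \<open>(p,q)\<close> of \<open>Y\<close> without
  transposition. The factor \<open>2^n\<close> later cancels against the normalisation of
  \<open>pdm_BA\<close>.\<close>

lemma pauli_expansion:
  assumes Y: "Y \<in> carrier_mat (2^n) (2^n)" and pq: "p < 2^n" "q < 2^n"
  shows "(\<Sum>k<4^n. trace (pauli n k * Y) * pauli n k $$ (p,q)) = 2^n * Y $$ (p,q)"
proof -
  have "(\<Sum>k<4^n. trace (pauli n k * Y) * pauli n k $$ (p,q)) =
     (\<Sum>k<4^n. \<Sum>i<2^n. \<Sum>j<2^n. Y $$ (j,i) * (pauli n k $$ (p,q) * pauli n k $$ (i,j)))"
    by (simp add: trace_mult[OF pauli_carrier Y] sum_distrib_left sum_distrib_right ac_simps)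
  also have "\<dots> = (\<Sum>i<2^n. \<Sum>j<2^n. \<Sum>k<4^n. Y $$ (j,i) * (pauli n k $$ (p,q) * pauli n k $$ (i,j)))"
    by (subst sum.swap, rule sum.cong[OF refl], rule sum.swap)
  also have "\<dots> = (\<Sum>i<2^n. \<Sum>j<2^n. if i = q then (if j = p then 2^n * Y $$ (p,q) else 0) else 0)"
    unfolding sum_distrib_left[symmetric] using pq
    by (intro sum.cong refl) (simp add: pauli_completeness)
  also have "\<dots> = (\<Sum>i<2^n. if i = q then 2^n * Y $$ (p,q) else 0)"
    using pq by (intro sum.cong) auto
  also have "\<dots> = 2^n * Y $$ (p,q)" using pq by simp
  finally show ?thesis .
qed

section \<open>Partial traces and coarse-grained measurements\<close>

lemma trace_ptrace2:
  "X \<in> carrier_mat (a*b) (a*b) \<Longrightarrow> trace (ptrace2 a b X) = trace X"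
  by (simp add: trace_def ptrace2_def sum_lessThan_mult)

text \<open>The measurement on \<open>A\<close> at the later time sees only the reduced output of
  \<open>P\<close>, the object about which the no-signalling equation speaks.\<close>

lemma trace_kron_one:
  assumes A: "A \<in> carrier_mat a a" and X: "X \<in> carrier_mat (a*b) (a*b)"
  shows "trace (kron A (1\<^sub>m b) * X) = trace (A * ptrace2 a b X)"
proof -
  have K: "kron A (1\<^sub>m b) \<in> carrier_mat (a*b) (a*b)"
    using A by (intro kron_carrier) auto
  have "trace (kron A (1\<^sub>m b) * X) = (\<Sum>x<a. \<Sum>y<b. \<Sum>x'<a. \<Sum>y'<b.
      kron A (1\<^sub>m b) $$ (x*b+y, x'*b+y') * X $$ (x'*b+y', x*b+y))"
    by (simp add: trace_mult[OF K X] sum_lessThan_mult)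
  also have "\<dots> = (\<Sum>x<a. \<Sum>y<b. \<Sum>x'<a. \<Sum>y'<b.
      if y' = y then A $$ (x,x') * X $$ (x'*b+y, x*b+y) else 0)"
    by (intro sum.cong refl) (auto simp: kron_index[OF A one_carrier_mat])
  also have "\<dots> = (\<Sum>x<a. \<Sum>y<b. \<Sum>x'<a. A $$ (x,x') * X $$ (x'*b+y, x*b+y))"
    by (intro sum.cong refl) simp
  also have "\<dots> = (\<Sum>x<a. \<Sum>x'<a. \<Sum>y<b. A $$ (x,x') * X $$ (x'*b+y, x*b+y))"
    by (rule sum.cong[OF refl], rule sum.swap)
  also have "\<dots> = trace (A * ptrace2 a b X)"
    using A by (subst trace_mult[of _ a]) (auto simp: ptrace2_def sum_distrib_left)
  finally show ?thesis .
qed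

lemma proj_carrier: "S \<in> carrier_mat d d \<Longrightarrow> proj d a S \<in> carrier_mat d d"
  by (simp add: proj_def)

lemma proj_index: "S \<in> carrier_mat d d \<Longrightarrow> i < d \<Longrightarrow> j < d \<Longrightarrow>
   proj d a S $$ (i,j) = ((if i = j then 1 else 0) + a * S $$ (i,j)) / 2"
  by (simp add: proj_def)

lemma trace_proj_diff:
  assumes S: "S \<in> carrier_mat d d" and X: "X \<in> carrier_mat d d"
  shows "trace (proj d 1 S * X) - trace (proj d (-1) S * X) = trace (S * X)"
  unfolding trace_mult[OF S X] trace_mult[OF proj_carrier[OF S] X] sum_subtractf[symmetric]
  by (intro sum.cong refl) (simp add: proj_index[OF S] field_simps)

lemma psd_luders:
  assumes "psd d \<rho>" "S \<in> carrier_mat d d" "adj S = S" "a \<in> \<real>"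
  shows "psd d (proj d a S * \<rho> * proj d a S)"
proof (rule psd_congruence)
  have S: "cnj (S $$ (j,i)) = S $$ (i,j)" if "i < d" "j < d" for i j
  proof -
    have "S $$ (i,j) = adj S $$ (i,j)" by (simp add: assms(3))
    then show ?thesis using assms(2) that by (simp add: adj_def)
  qed
  show "adj (proj d a S) = proj d a S"
    using assms(2,4) by (intro eq_matI)
      (auto simp: adj_def proj_def S Reals_cnj_iff)
qed (use assms proj_carrier in auto)

text \<open>In the expansion of \<open>(1 + a S) \<rho> (1 + a S) / 4\<close> the terms
  \<open>\<rho>\<close> and \<open>S \<rho> S\<close> are even in the sign \<open>a = 1, -1\<close>
  and cancel, while the cross terms are odd and double.\<close>

lemma luders_diff:
  assumes S: "S \<in> carrier_mat d d" and \<rho>: "\<rho> \<in> carrier_mat d d" and ij: "i < d" "j < d"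
  shows "(proj d 1 S * \<rho> * proj d 1 S) $$ (i,j) - (proj d (-1) S * \<rho> * proj d (-1) S) $$ (i,j) =
    ((S * \<rho>) $$ (i,j) + (\<rho> * S) $$ (i,j)) / 2"
proof -
  have e: "(proj d a S * \<rho> * proj d a S) $$ (i,j) =
     (\<Sum>l<d. \<Sum>k<d. proj d a S $$ (i,k) * \<rho> $$ (k,l) * proj d a S $$ (l,j))" for a
    unfolding index_mult_mat_sum[OF mult_carrier_mat[OF proj_carrier[OF S] \<rho>] proj_carrier[OF S] ij]
    using ij by (simp add: index_mult_mat_sum[OF proj_carrier[OF S] \<rho>] sum_distrib_right
        del: index_mult_mat)
  have "(proj d 1 S * \<rho> * proj d 1 S) $$ (i,j) - (proj d (-1) S * \<rho> * proj d (-1) S) $$ (i,j) =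
     (\<Sum>l<d. \<Sum>k<d. (if l = j then S $$ (i,k) * \<rho> $$ (k,j) / 2 else 0) +
        (if k = i then \<rho> $$ (i,l) * S $$ (l,j) / 2 else 0))"
    unfolding e sum_subtractf[symmetric] using ij
    by (intro sum.cong refl) (auto simp: proj_index[OF S] field_simps)
  also have "\<dots> = (\<Sum>l<d. (if l = j then (\<Sum>k<d. S $$ (i,k) * \<rho> $$ (k,j) / 2) else 0)) +
      (\<Sum>l<d. \<rho> $$ (i,l) * S $$ (l,j) / 2)"
  proof -
    have "(\<Sum>l<d. \<Sum>k<d. if l = j then S $$ (i,k) * \<rho> $$ (k,j) / 2 else 0) =
        (\<Sum>l<d. (if l = j then (\<Sum>k<d. S $$ (i,k) * \<rho> $$ (k,j) / 2) else 0))"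
      by (intro sum.cong refl) auto
    then show ?thesis unfolding sum.distrib using ij by simp
  qed
  also have "\<dots> = ((S * \<rho>) $$ (i,j) + (\<rho> * S) $$ (i,j)) / 2"
    using ij by (simp add: index_mult_mat_sum[OF S \<rho>] index_mult_mat_sum[OF \<rho> S] add_divide_distrib
        sum_divide_distrib del: index_mult_mat)
  finally show ?thesis .
qed

text \<open>A partial trace is cyclic for operators acting on the traced factor alone, so both
  orders give one and the same expression.\<close>

lemma ptrace2_one_kron:
  assumes C: "C \<in> carrier_mat b b" and \<rho>: "\<rho> \<in> carrier_mat (a*b) (a*b)" and pq: "p < a" "q < a"
  shows "ptrace2 a b (kron (1\<^sub>m a) C * \<rho>) $$ (p,q) =
      (\<Sum>s<b. \<Sum>t<b. C $$ (s,t) * \<rho> $$ (p*b+t, q*b+s))" (is ?A)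
    and "ptrace2 a b (\<rho> * kron (1\<^sub>m a) C) $$ (p,q) =
      (\<Sum>s<b. \<Sum>t<b. C $$ (s,t) * \<rho> $$ (p*b+t, q*b+s))" (is ?B)
proof -
  have K: "kron (1\<^sub>m a) C \<in> carrier_mat (a*b) (a*b)"
    using C by (intro kron_carrier) auto
  have "ptrace2 a b (kron (1\<^sub>m a) C * \<rho>) $$ (p,q) =
      (\<Sum>s<b. \<Sum>x<a. \<Sum>t<b. kron (1\<^sub>m a) C $$ (p*b+s, x*b+t) * \<rho> $$ (x*b+t, q*b+s))"
    using pq by (simp add: ptrace2_def index_mult_mat_sum[OF K \<rho>] mult_add_less_mult sum_lessThan_mult
        del: index_mult_mat)
  also have "\<dots> = (\<Sum>s<b. \<Sum>x<a. if x = p then (\<Sum>t<b. C $$ (s,t) * \<rho> $$ (p*b+t, q*b+s)) else 0)"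
    using pq by (intro sum.cong refl) (auto simp: kron_index[OF one_carrier_mat C])
  finally show ?A using pq by simp
  have "ptrace2 a b (\<rho> * kron (1\<^sub>m a) C) $$ (p,q) =
      (\<Sum>t<b. \<Sum>x<a. \<Sum>s<b. \<rho> $$ (p*b+t, x*b+s) * kron (1\<^sub>m a) C $$ (x*b+s, q*b+t))"
    using pq by (simp add: ptrace2_def index_mult_mat_sum[OF \<rho> K] mult_add_less_mult sum_lessThan_mult
        del: index_mult_mat)
  also have "\<dots> = (\<Sum>t<b. \<Sum>x<a. if x = q then (\<Sum>s<b. C $$ (s,t) * \<rho> $$ (p*b+t, q*b+s)) else 0)"
    using pq by (intro sum.cong refl) (auto simp: kron_index[OF one_carrier_mat C] intro!: sum.cong)
  also have "\<dots> = (\<Sum>t<b. \<Sum>s<b. C $$ (s,t) * \<rho> $$ (p*b+t, q*b+s))" using pq by simp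
  also have "\<dots> = (\<Sum>s<b. \<Sum>t<b. C $$ (s,t) * \<rho> $$ (p*b+t, q*b+s))" by (rule sum.swap)
  finally show ?B .
qed

section \<open>No-signalling for unnormalised states\<close>

lemma psd_trace:
  assumes "psd n A"
  shows "trace A \<in> \<real>" "0 \<le> Re (trace A)"
proof -
  have t: "trace A = (\<Sum>j<n. sesq n A (\<lambda>i. if i = j then 1 else 0) (\<lambda>i. if i = j then 1 else 0))"
    using psd_carrier[OF assms] by (simp add: trace_def sesq_units)
  show "trace A \<in> \<real>" unfolding t by (intro sum_in_Reals psd_sesq_real[OF assms])
  show "0 \<le> Re (trace A)" unfolding t Re_sum by (intro sum_nonneg psd_sesq_nonneg[OF assms])
qed

lemma trace_smult: "A \<in> carrier_mat n n \<Longrightarrow> trace (c \<cdot>\<^sub>m A) = c * trace A"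
  by (simp add: trace_def sum_distrib_left)

lemma sesq_smult: "A \<in> carrier_mat n n \<Longrightarrow> sesq n (c \<cdot>\<^sub>m A) u v = c * sesq n A u v"
  by (simp add: sesq_def sum_distrib_left algebra_simps)

lemma density_normalize:
  assumes M: "psd n M" and t: "trace M \<noteq> 0"
  shows "density n ((1 / trace M) \<cdot>\<^sub>m M)"
proof -
  have c: "M \<in> carrier_mat n n" by (rule psd_carrier[OF M])
  obtain r where r: "trace M = complex_of_real r"
    using psd_trace(1)[OF M] by (rule Reals_cases)
  have r0: "r \<ge> 0" using psd_trace(2)[OF M] by (simp add: r)
  have "psd n ((1 / trace M) \<cdot>\<^sub>m M)"
    unfolding psd_iff_sesq sesq_smult[OF c]
  proof (intro conjI allI)
    fix v
    obtain x where x: "sesq n M v v = complex_of_real x"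
      using psd_sesq_real[OF M] by (rule Reals_cases)
    have e: "1 / trace M * sesq n M v v = complex_of_real (x / r)" by (simp add: r x)
    show "1 / trace M * sesq n M v v \<in> \<real>" unfolding e by (rule Reals_of_real)
    show "0 \<le> Re (1 / trace M * sesq n M v v)"
      unfolding e using r0 psd_sesq_nonneg[OF M, of v] x by simp
  qed (use c in simp)
  moreover have "trace ((1 / trace M) \<cdot>\<^sub>m M) = (1 / trace M) * trace M"
    by (rule trace_smult[OF c])
  ultimately show ?thesis using t by (simp add: density_def)
qed

lemma ptrace2_carrier: "ptrace2 a b X \<in> carrier_mat a a"
  by (simp add: ptrace2_def)

lemma ptrace2_smult:
  "X \<in> carrier_mat (a*b) (a*b) \<Longrightarrow> ptrace2 a b (c \<cdot>\<^sub>m X) = c \<cdot>\<^sub>m ptrace2 a b X"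
  by (intro eq_matI) (auto simp: ptrace2_def sum_distrib_left mult_add_less_mult)

text \<open>Both sides are homogeneous in the state, so the equation for \<open>M / trace M\<close>
  scales back to \<open>M\<close>. A positive matrix of trace zero cannot be normalised, but it is
  the zero matrix.\<close>

lemma nonsignalling_psd:
  assumes P: "linear_on (a*b) (a*b) P" and T: "linear_on a a T"
    and ns: "\<And>\<sigma>. density (a*b) \<sigma> \<Longrightarrow> ptrace2 a b (P \<sigma>) = T (ptrace2 a b \<sigma>)"
    and M: "psd (a*b) M"
  shows "ptrace2 a b (P M) = T (ptrace2 a b M)"
proof -
  have c: "M \<in> carrier_mat (a*b) (a*b)" by (rule psd_carrier[OF M])
  have scale: "ptrace2 a b (P (k \<cdot>\<^sub>m X)) = k \<cdot>\<^sub>m ptrace2 a b (P X)"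
    "T (ptrace2 a b (k \<cdot>\<^sub>m X)) = k \<cdot>\<^sub>m T (ptrace2 a b X)"
    if X: "X \<in> carrier_mat (a*b) (a*b)" for k X
  proof -
    show "ptrace2 a b (P (k \<cdot>\<^sub>m X)) = k \<cdot>\<^sub>m ptrace2 a b (P X)"
      unfolding linear_on_smult[OF P X] by (rule ptrace2_smult[OF linear_on_carrier[OF P X]])
    show "T (ptrace2 a b (k \<cdot>\<^sub>m X)) = k \<cdot>\<^sub>m T (ptrace2 a b X)"
      unfolding ptrace2_smult[OF X] by (rule linear_on_smult[OF T ptrace2_carrier])
  qed
  show ?thesis
  proof (cases "trace M = 0")
    case True
    \<comment> \<open>Since \<open>M\<close> equals its own multiple by 0, homogeneity shows each
      side to be 0 times itself.\<close>
    then have M0: "0 \<cdot>\<^sub>m M = M" unfolding psd_trace_eq_0[OF M True] by simp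
    have car: "ptrace2 a b (P M) \<in> carrier_mat a a" "T (ptrace2 a b M) \<in> carrier_mat a a"
      by (rule ptrace2_carrier, rule linear_on_carrier[OF T ptrace2_carrier])
    have "ptrace2 a b (P M) = 0 \<cdot>\<^sub>m ptrace2 a b (P M)"
      using scale(1)[OF c, of 0] unfolding M0 .
    also have "\<dots> = 0 \<cdot>\<^sub>m T (ptrace2 a b M)"
      using carrier_matD[OF car(1)] carrier_matD[OF car(2)] by (intro eq_matI) auto
    also have "\<dots> = T (ptrace2 a b M)"
      using scale(2)[OF c, of 0] unfolding M0 by (rule sym)
    finally show ?thesis .
  next
    case False
    let ?\<sigma> = "(1 / trace M) \<cdot>\<^sub>m M"
    have M': "trace M \<cdot>\<^sub>m ?\<sigma> = M" using False by (intro eq_matI) auto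
    have \<sigma>: "?\<sigma> \<in> carrier_mat (a*b) (a*b)" using c by simp
    have "ptrace2 a b (P (trace M \<cdot>\<^sub>m ?\<sigma>)) = T (ptrace2 a b (trace M \<cdot>\<^sub>m ?\<sigma>))"
      unfolding scale[OF \<sigma>] ns[OF density_normalize[OF M False]] ..
    then show ?thesis unfolding M' .
  qed
qed

section \<open>The pseudo-density matrix as an image of the state\<close>

text \<open>The difference of the two post-measurement states is the Jordan product
  \<open>(\<Sigma> \<rho> + \<rho> \<Sigma>) / 2\<close>; under the trace over \<open>B\<close> both orders agree, which leaves the
  Pauli coefficients of the \<open>B\<close>-blocks of \<open>\<rho>\<close>.\<close>

lemma corr_eq:
  fixes nA nB :: nat
  defines "a \<equiv> 2^nA" and "b \<equiv> 2^nB"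
  assumes P: "linear_on (a*b) (a*b) P" and T: "linear_on a a T"
    and ns: "\<And>\<sigma>. density (a*b) \<sigma> \<Longrightarrow> ptrace2 a b (P \<sigma>) = T (ptrace2 a b \<sigma>)"
    and \<rho>: "psd (a*b) \<rho>"
  shows "corr nA nB P \<rho> j k = trace (pauli nA k * T (mat a a (\<lambda>(p,q).
    trace (pauli nB j * mat b b (\<lambda>(t,s). \<rho> $$ (p*b+t, q*b+s))))))"
proof -
  define S1 where "S1 = kron (1\<^sub>m a) (pauli nB j)"
  define S2 where "S2 = kron (pauli nA k) (1\<^sub>m b)"
  define M where "M x = proj (a*b) x S1 * \<rho> * proj (a*b) x S1" for x
  define N where "N x = ptrace2 a b (M x)" for x
  let ?Z = "mat a a (\<lambda>(p,q). trace (pauli nB j * mat b b (\<lambda>(t,s). \<rho> $$ (p*b+t, q*b+s))))"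
  have \<rho>c: "\<rho> \<in> carrier_mat (a*b) (a*b)" by (rule psd_carrier[OF \<rho>])
  have pA: "pauli nA k \<in> carrier_mat a a" and pB: "pauli nB j \<in> carrier_mat b b"
    using pauli_carrier by (auto simp: a_def b_def)
  have S1c: "S1 \<in> carrier_mat (a*b) (a*b)" and S2c: "S2 \<in> carrier_mat (a*b) (a*b)"
    unfolding S1_def S2_def using pA pB by (auto intro!: kron_carrier)
  have S1adj: "adj S1 = S1"
  proof (rule eq_matI)
    fix i l assume "i < dim_row S1" "l < dim_col S1"
    then have il: "i < a*b" "l < a*b" using S1c by auto
    then have m: "i mod b < b" "l mod b < b" "i div b < a" "l div b < a"
      by (auto intro: mod_less_mult less_mult_imp_div_less)
    have "adj S1 $$ (i,l) = cnj (S1 $$ (l,i))" using il S1c by (simp add: adj_def)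
    also have "\<dots> = S1 $$ (i,l)"
      unfolding S1_def kron_index_div[OF one_carrier_mat pB il(2,1)]
        kron_index_div[OF one_carrier_mat pB il]
      using m by (auto simp: pauli_hermitian b_def)
    finally show "adj S1 $$ (i,l) = S1 $$ (i,l)" .
  qed (use S1c in \<open>auto simp: adj_def\<close>)
  have Mpsd: "psd (a*b) (M x)" if "x \<in> {1,-1}" for x
    unfolding M_def using that by (intro psd_luders \<rho> S1c S1adj) auto
  have PM: "P (M x) \<in> carrier_mat (a*b) (a*b)" if "x \<in> {1,-1}" for x
    by (rule linear_on_carrier[OF P psd_carrier[OF Mpsd[OF that]]])
  have S2P: "trace (S2 * P (M x)) = trace (pauli nA k * T (N x))" if "x \<in> {1,-1}" for x
    using trace_kron_one[OF pA PM[OF that]] nonsignalling_psd[OF P T ns Mpsd[OF that]]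
    by (simp add: S2_def N_def)
  \<comment> \<open>A sum over the outcome set \<open>{1,-1}\<close> has two separate terms only
    because its elements differ.\<close>
  have ne: "(1::complex) \<noteq> -1" by simp
  have Nc: "N x \<in> carrier_mat a a" for x by (simp add: N_def ptrace2_carrier)
  note Tc = linear_on_carrier[OF T]
  \<comment> \<open>As a signed sum over the outcomes, \<open>?Z\<close> is split by linearity into
    the two values \<open>T (N x)\<close>, each of which no-signalling identifies with a reduced
    output of \<open>P\<close>.\<close>
  have Z: "?Z = mat a a (\<lambda>(p,q). \<Sum>x\<in>{1,-1}. x * N x $$ (p,q))"
  proof (rule cong_mat)
    fix p q assume pq: "p < a" "q < a"
    let ?s = "\<Sum>s<b. \<Sum>t<b. pauli nB j $$ (s,t) * \<rho> $$ (p*b+t, q*b+s)"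
    have "(\<Sum>x\<in>{1,-1}. x * N x $$ (p,q)) = N 1 $$ (p,q) - N (-1) $$ (p,q)"
      using ne by simp
    also have "\<dots> = (\<Sum>y<b. M 1 $$ (p*b+y,q*b+y) - M (-1) $$ (p*b+y,q*b+y))"
      using pq by (simp add: N_def ptrace2_def sum_subtractf)
    also have "\<dots> = (\<Sum>y<b. ((S1 * \<rho>) $$ (p*b+y,q*b+y) + (\<rho> * S1) $$ (p*b+y,q*b+y)) / 2)"
      unfolding M_def using pq
      by (intro sum.cong refl luders_diff S1c \<rho>c) (auto simp: mult_add_less_mult)
    also have "\<dots> = (ptrace2 a b (S1 * \<rho>) $$ (p,q) + ptrace2 a b (\<rho> * S1) $$ (p,q)) / 2"
      using pq by (simp add: ptrace2_def sum.distrib flip: sum_divide_distrib)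
    also have "\<dots> = ?s"
      unfolding S1_def ptrace2_one_kron[OF pB \<rho>c pq] by simp
    also have "\<dots> = trace (pauli nB j * mat b b (\<lambda>(t,s). \<rho> $$ (p*b+t, q*b+s)))"
      by (subst trace_mult[OF pB]) auto
    finally show "(case (p,q) of (p,q) \<Rightarrow>
        trace (pauli nB j * mat b b (\<lambda>(t,s). \<rho> $$ (p*b+t, q*b+s)))) =
        (case (p,q) of (p,q) \<Rightarrow> \<Sum>x\<in>{1,-1}. x * N x $$ (p,q))" by simp
  qed auto
  have TZ: "T ?Z $$ (p,q) = T (N 1) $$ (p,q) - T (N (-1)) $$ (p,q)" if "p < a" "q < a" for p q
    unfolding Z using ne by (subst linear_on_sum[OF T _ Nc that]) auto
  have "corr nA nB P \<rho> j k =
      (trace (proj (a*b) 1 S2 * P (M 1)) - trace (proj (a*b) (-1) S2 * P (M 1))) -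
      (trace (proj (a*b) 1 S2 * P (M (-1))) - trace (proj (a*b) (-1) S2 * P (M (-1))))"
    using ne unfolding corr_def Let_def M_def S1_def S2_def a_def b_def by simp
  also have "\<dots> = trace (pauli nA k * T (N 1)) - trace (pauli nA k * T (N (-1)))"
    using trace_proj_diff[OF S2c PM[of 1]] trace_proj_diff[OF S2c PM[of "-1"]]
      S2P[of 1] S2P[of "-1"] by simp
  also have "\<dots> = trace (pauli nA k * T ?Z)"
  proof -
    have Zc: "?Z \<in> carrier_mat a a" by simp
    show ?thesis
      unfolding trace_mult[OF pA Tc[OF Nc]] trace_mult[OF pA Tc[OF Zc]] sum_subtractf[symmetric]
      by (intro sum.cong refl) (simp add: TZ right_diff_distrib)
  qed
  finally show ?thesis .
qed

text \<open>At fixed \<open>B\<close>-indices the sum over \<open>k\<close> rebuilds the matrix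
  \<open>T (?Z j)\<close> from its Pauli coefficients. The sum over \<open>j\<close> then moves
  inside \<open>T\<close> by linearity, where it rebuilds a block of the factor-exchanged
  \<open>\<rho>\<close>.\<close>

lemma pdm_BA_eq_ampliate:
  fixes nA nB :: nat
  defines "a \<equiv> 2^nA" and "b \<equiv> 2^nB"
  assumes P: "linear_on (a*b) (a*b) P" and T: "linear_on a a T"
    and ns: "\<And>\<sigma>. density (a*b) \<sigma> \<Longrightarrow> ptrace2 a b (P \<sigma>) = T (ptrace2 a b \<sigma>)"
    and \<rho>: "psd (a*b) \<rho>"
  shows "pdm_BA nA nB P \<rho> = ampliate b a a T (mat (b*a) (b*a)
    (\<lambda>(i,j). \<rho> $$ (i mod a * b + i div a, j mod a * b + j div a)))" (is "_ = ampliate b a a T ?X")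
proof (rule eq_matI)
  fix r c assume "r < dim_row (ampliate b a a T ?X)" "c < dim_col (ampliate b a a T ?X)"
  then have rc: "r < b*a" "c < b*a" by (auto simp: ampliate_def)
  have m: "r div a < b" "c div a < b" "r mod a < a" "c mod a < a"
    using rc by (auto intro: less_mult_imp_div_less mod_less_mult)
  let ?Y = "\<lambda>p q. mat b b (\<lambda>(t,s). \<rho> $$ (p*b+t, q*b+s))"
  let ?Z = "\<lambda>j. mat a a (\<lambda>(p,q). trace (pauli nB j * ?Y p q))"
  have pA: "pauli nA k \<in> carrier_mat a a" and pB: "pauli nB j \<in> carrier_mat b b" for j k
    using pauli_carrier by (auto simp: a_def b_def)
  have TZ: "T (?Z j) \<in> carrier_mat a a" for j
    by (rule linear_on_carrier[OF T]) simp
  have corr: "corr nA nB P \<rho> j k = trace (pauli nA k * T (?Z j))" for j k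
    unfolding a_def b_def by (rule corr_eq) (use P T ns \<rho> in \<open>auto simp: a_def b_def\<close>)
  \<comment> \<open>The divisor \<open>of_nat b\<close> is the share of \<open>B\<close> in the
    prefactor of \<open>pdm_BA\<close>; the share \<open>2^nA\<close> is absorbed by the expansion
    over \<open>k\<close>.\<close>
  have blk: "mat a a (\<lambda>(p,q). \<Sum>j<4^nB. (pauli nB j $$ (r div a, c div a) / of_nat b) * ?Z j $$ (p,q)) =
      blk a ?X (r div a) (c div a)" (is "?L = _")
  proof (rule eq_matI)
    fix p q assume "p < dim_row (blk a ?X (r div a) (c div a))" "q < dim_col (blk a ?X (r div a) (c div a))"
    then have pq: "p < a" "q < a" by (auto simp: blk_def)
    have "?L $$ (p,q) = (\<Sum>j<4^nB. trace (pauli nB j * ?Y p q) * pauli nB j $$ (r div a, c div a)) / of_nat b"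
      using pq by (simp add: sum_divide_distrib mult.commute)
    also have "\<dots> = ?Y p q $$ (r div a, c div a)"
      using m by (subst pauli_expansion) (auto simp: b_def)
    also have "\<dots> = blk a ?X (r div a) (c div a) $$ (p,q)"
      using pq m by (simp add: blk_def mult_add_less_mult)
    finally show "?L $$ (p,q) = blk a ?X (r div a) (c div a) $$ (p,q)" .
  qed (auto simp: blk_def)
  have "pdm_BA nA nB P \<rho> $$ (r,c) = (1 / 2^(nA+nB)) * (\<Sum>j<4^nB. \<Sum>k<4^nA.
      trace (pauli nA k * T (?Z j)) * kron (pauli nB j) (pauli nA k) $$ (r,c))"
    using rc unfolding pdm_BA_def corr a_def b_def by simp
  also have "\<dots> = (1 / 2^(nA+nB)) * (\<Sum>j<4^nB. pauli nB j $$ (r div a, c div a) *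
      (\<Sum>k<4^nA. trace (pauli nA k * T (?Z j)) * pauli nA k $$ (r mod a, c mod a)))"
    unfolding kron_index_div[OF pB pA rc] sum_distrib_left by (simp only: mult.left_commute)
  also have "\<dots> = (1 / 2^(nA+nB)) * (\<Sum>j<4^nB. pauli nB j $$ (r div a, c div a) *
      (2^nA * T (?Z j) $$ (r mod a, c mod a)))"
    using pauli_expansion[of "T (?Z _)" nA] TZ m unfolding a_def by simp
  also have "\<dots> = (\<Sum>j<4^nB. (pauli nB j $$ (r div a, c div a) / of_nat b) *
      T (?Z j) $$ (r mod a, c mod a))"
    unfolding sum_distrib_left by (intro sum.cong refl) (simp add: b_def power_add)
  also have "\<dots> = T ?L $$ (r mod a, c mod a)"
    by (rule linear_on_sum[OF T _ _ m(3,4), symmetric]) auto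
  also have "\<dots> = ampliate b a a T ?X $$ (r,c)"
    unfolding blk using rc by (simp add: ampliate_def)
  finally show "pdm_BA nA nB P \<rho> $$ (r,c) = ampliate b a a T ?X $$ (r,c)" .
qed (auto simp: pdm_BA_def ampliate_def a_def b_def)

text \<open>The trace collects only the diagonal blocks, and by linearity \<open>T\<close> may be
  applied to their sum, which is the reduced state of \<open>A\<close>.\<close>

lemma trace_ampliate_swap:
  assumes T: "linear_on a a T"
  shows "trace (ampliate b a a T (mat (b*a) (b*a)
    (\<lambda>(i,j). \<rho> $$ (i mod a * b + i div a, j mod a * b + j div a)))) = trace (T (ptrace2 a b \<rho>))"
    (is "trace (ampliate b a a T ?X) = _")
proof -
  have pt: "mat a a (\<lambda>(p,q). \<Sum>x<b. 1 * blk a ?X x x $$ (p,q)) = ptrace2 a b \<rho>"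
    by (intro eq_matI) (auto simp: blk_def ptrace2_def mult_add_less_mult)
  have "T (ptrace2 a b \<rho>) \<in> carrier_mat a a"
    by (rule linear_on_carrier[OF T ptrace2_carrier])
  then have "trace (T (ptrace2 a b \<rho>)) = (\<Sum>y<a. T (ptrace2 a b \<rho>) $$ (y,y))"
    by (simp add: trace_def)
  also have "\<dots> = (\<Sum>y<a. \<Sum>x<b. 1 * T (blk a ?X x x) $$ (y,y))"
    unfolding pt[symmetric]
    by (intro sum.cong refl linear_on_sum[OF T]) (auto simp: blk_def)
  also have "\<dots> = (\<Sum>x<b. \<Sum>y<a. T (blk a ?X x x) $$ (y,y))"
    by (subst sum.swap) simp
  also have "\<dots> = trace (ampliate b a a T ?X)"
    by (simp add: trace_def ampliate_def sum_lessThan_mult mult_add_less_mult)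
  finally show ?thesis ..
qed

theorem theorem3:
  fixes nA nB :: nat and P :: "complex mat \<Rightarrow> complex mat" and \<rho> :: "complex mat"
  assumes "cptp (2^nA * 2^nB) (2^nA * 2^nB) P"
    and "\<exists>T. completely_positive (2^nA) (2^nA) T \<and>
           (\<forall>\<sigma>. density (2^nA * 2^nB) \<sigma> \<longrightarrow>
              ptrace2 (2^nA) (2^nB) (P \<sigma>) = T (ptrace2 (2^nA) (2^nB) \<sigma>))"
    and "density (2^nA * 2^nB) \<rho>"
  shows "psd (2^nB * 2^nA) (pdm_BA nA nB P \<rho>) \<and> pdm_negativity (pdm_BA nA nB P \<rho>) = 0"
proof -
  let ?a = "2^nA :: nat" and ?b = "2^nB :: nat"
  obtain T where T: "completely_positive ?a ?a T"
    and ns: "\<And>\<sigma>. density (?a*?b) \<sigma> \<Longrightarrow> ptrace2 ?a ?b (P \<sigma>) = T (ptrace2 ?a ?b \<sigma>)"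
    using assms(2) by blast
  have P: "linear_on (?a*?b) (?a*?b) P" and linT: "linear_on ?a ?a T"
    and \<rho>: "psd (?a*?b) \<rho>" "trace \<rho> = 1"
    using assms(1,3) T by (auto simp: cptp_def completely_positive_def density_def)
  let ?X = "mat (?b*?a) (?b*?a) (\<lambda>(i,j). \<rho> $$ (i mod ?a * ?b + i div ?a, j mod ?a * ?b + j div ?a))"
  have R: "pdm_BA nA nB P \<rho> = ampliate ?b ?a ?a T ?X"
    by (rule pdm_BA_eq_ampliate[OF P linT ns \<rho>(1)])
  have psd: "psd (?b*?a) (pdm_BA nA nB P \<rho>)"
    unfolding R using T psd_swap_factors[OF \<rho>(1)] unfolding completely_positive_def by blast
  have \<rho>c: "\<rho> \<in> carrier_mat (?a*?b) (?a*?b)" by (rule psd_carrier[OF \<rho>(1)])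
  \<comment> \<open>Trace preservation is a hypothesis on \<open>P\<close>, so the no-signalling
    equation at \<open>\<rho>\<close> itself carries the trace from \<open>T\<close> back to
    \<open>P\<close>.\<close>
  have "trace (pdm_BA nA nB P \<rho>) = trace (ptrace2 ?a ?b (P \<rho>))"
    unfolding R trace_ampliate_swap[OF linT] ns[OF assms(3)] ..
  also have "\<dots> = trace (P \<rho>)"
    by (rule trace_ptrace2[OF linear_on_carrier[OF P \<rho>c]])
  also have "\<dots> = 1" using assms(1) \<rho>c \<rho>(2) unfolding cptp_def by auto
  finally show ?thesis
    using psd by (simp add: pdm_negativity_def trace_norm_psd[OF psd])
qed

end
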